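(* Let $D$ be a statistical depth on $\mathbb{R}^d$ and $E\subseteq\mathbb{R}^d$ a state space. The following assertions hold. (i) (Continuity in $\mathbf{x}$) Let $\Pi$ be a transition probability on $E$. Suppose that: (a) for any law $P$ on $\mathbb{R}^d$, the mapping $x\in\mathbb{R}^d\mapsto D_P(x)$ is continuous; (b) for any probability distributions $P$ and $P_n$, $n\geq 1$, on $\mathbb{R}^d$ such that $P_n\Rightarrow P$ as $n\to\infty$, $\sup_{x\in\mathbb{R}^d}|D_{P_n}(x)-D_P(x)|\to0$ as $n\to\infty$; (c) the function $x\in E\mapsto\Pi_x\in\mathcal{M}_1(E)$ is continuous, where $\mathcal{M}_1(E)$ is the set of probability measures on $E$ equipped with the weak convergence topology. Then the mapping $\mathbf{x}\in\mathbb{T}\mapsto D_\Pi(\mathbf{x})$ is continuous. (ii) (Continuity in $\Pi$) Suppose that for any probability distributions $P$ and $P_n$, $n\geq 1$, on $\mathbb{R}^d$ such that $P_n\Rightarrow P$ as $n\to\infty$, one has $|D_{P_n}(x)-D_P(x)|\to0$ for every $x\in\mathbb{R}^d$. Let $\Pi$ and $\Pi^{(n)}$, $n\ge1$, be transition probabilities on $E$ such that for all $x\in E$, $\Pi^{(n)}_x\Rightarrow\Pi_x$ as $n\to\infty$. Then for all $\mathbf{x}\in\mathbb{T}$, $D_{\Pi^{(n)}}(\mathbf{x})\to D_\Pi(\mathbf{x})$ as $n\to\infty$.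
   Context: A statistical depth $D$ assigns to every probability distribution $P$ on $\mathbb{R}^d$ a bounded non-negative Borel function $D_P:\mathbb{R}^d\to\mathbb{R}_+$. Distributions on $E$ are viewed as distributions on $\mathbb{R}^d$. $\Rightarrow$ denotes convergence in distribution (weak convergence). A transition probability on $E$ is a kernel $(x,A)\in E\times\mathcal{B}(E)\mapsto\Pi_x(A)$. Markovian sample path depth: for $n\ge1$ and $\mathbf{x}=(x_0,\ldots,x_n)\in E^{n+1}$, $D_\Pi(\mathbf{x})=\left(\prod_{i=1}^nD_{\Pi_{x_{i-1}}}(x_i)\right)^{1/n}$, with the convention $\sqrt[n]{0}=0$. Path space: $\mathbb{T}=\bigcup_{n\ge1}E^n$, the space of all paths of finite length in $E$; paths at which $D_\Pi$ is evaluated have at least one transition, i.e. belong to some $E^{n+1}$ with $n\ge1$. Its topology is that in which $O\subset\mathbb{T}$ is open iff $O\cap E^n$ is open in $E^n$ for all $n\ge1$; thus a function on $\mathbb{T}$ is continuous iff its restriction to each $E^n$ is continuous, and $\mathbf{x}_k\to\mathbf{x}\in E^n$ iff $\mathbf{x}_k\in E^n$ for all large $k$ and $\mathbf{x}_k\to\mathbf{x}$ in $E^n$. *)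

theory Defs
  imports "HOL-Probability.Probability"
begin

text \<open>The set \<open>M\<^sub>1(E)\<close> of Borel probability measures on a subspace \<open>E\<close>, which need not be a
  Borel set: the sigma-algebra of \<open>restrict_space borel E\<close> is the Borel sigma-algebra of the
  subspace topology.\<close>

definition prob_laws :: "'a::topological_space set \<Rightarrow> 'a measure set" where
  "prob_laws E = space (prob_algebra (restrict_space borel E))"

definition statistical_depth :: "((real^'d) measure \<Rightarrow> real^'d \<Rightarrow> real) \<Rightarrow> bool" where
  "statistical_depth D \<longleftrightarrow>
     (\<forall>P \<in> prob_laws UNIV.
        D P \<in> borel_measurable borel \<and> bounded (range (D P)) \<and> (\<forall>x. 0 \<le> D P x))"

definition bounded_cont :: "'a::topological_space set \<Rightarrow> ('a \<Rightarrow> real) set" where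
  "bounded_cont E = {f. continuous_on E f \<and> bounded (f ` E)}"

text \<open>The library's \<open>weak_conv_m\<close> is about distribution functions on the real line only, so weak
  convergence is defined by test functions.\<close>

definition weakly_converges ::
  "'a::topological_space set \<Rightarrow> (nat \<Rightarrow> 'a measure) \<Rightarrow> 'a measure \<Rightarrow> bool" where
  "weakly_converges E Pn P \<longleftrightarrow>
     (\<forall>f \<in> bounded_cont E. (\<lambda>n. integral\<^sup>L (Pn n) f) \<longlonglongrightarrow> integral\<^sup>L P f)"

definition weak_topology :: "'a::topological_space set \<Rightarrow> 'a measure topology" where
  "weak_topology E = topology_generated_by
     {{P \<in> prob_laws E. integral\<^sup>L P f \<in> U} | f U. f \<in> bounded_cont E \<and> open U}"

definition transition_probability ::
  "'a::topological_space set \<Rightarrow> ('a \<Rightarrow> 'a measure) \<Rightarrow> bool" where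
  "transition_probability E \<kappa> \<longleftrightarrow>
     \<kappa> \<in> restrict_space borel E \<rightarrow>\<^sub>M prob_algebra (restrict_space borel E)"

text \<open>A law on \<open>E\<close> viewed as a law on the whole space, that is, its image under inclusion.\<close>

definition extend_law :: "'a::topological_space measure \<Rightarrow> 'a measure" where
  "extend_law P = distr P borel (\<lambda>x. x)"

text \<open>A path in \<open>E\<^sup>m\<close> is encoded as a pair \<open>(m, x)\<close> where \<open>x\<close> is an extensional function on
  \<open>{..<m}\<close>, so that the path space is the topological sum of the powers \<open>E\<^sup>m\<close>, \<open>m \<ge> 1\<close>.\<close>

definition path_topology :: "'a::topological_space set \<Rightarrow> (nat \<times> (nat \<Rightarrow> 'a)) topology" where
  "path_topology E = sum_topology (\<lambda>m. product_topology (\<lambda>_. top_of_set E) {..<m}) {1..}"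

text \<open>The paths \<open>(x\<^sub>0, \<dots>, x\<^sub>n)\<close> with \<open>n \<ge> 1\<close>, on which the path depth is defined;
  they have \<open>m = n + 1 \<ge> 2\<close> points.\<close>

definition paths :: "'a set \<Rightarrow> (nat \<times> (nat \<Rightarrow> 'a)) set" where
  "paths E = (SIGMA m:{2..}. {..<m} \<rightarrow>\<^sub>E E)"

definition path_depth ::
  "((real^'d) measure \<Rightarrow> real^'d \<Rightarrow> real) \<Rightarrow> (real^'d \<Rightarrow> (real^'d) measure) \<Rightarrow>
   nat \<times> (nat \<Rightarrow> real^'d) \<Rightarrow> real" where
  "path_depth D \<kappa> = (\<lambda>(m, x).
     let n = m - 1 in root n (\<Prod>i = 1..n. D (extend_law (\<kappa> (x (i - 1)))) (x i)))"

end

theory Submission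
  imports Defs
begin

text \<open>The path depth at a path with \<open>n\<close> transitions is a continuous function of \<open>n\<close> real factors
  \<open>D \<Pi>\<^sub>x y\<close>, one for each transition \<open>x \<rightarrow> y\<close>, so both assertions are about a single factor.

  Extending laws from \<open>E\<close> to the whole space preserves weak convergence, because a bounded
  continuous function on the whole space restricts to one on \<open>E\<close>
  (\<open>weakly_converges_extend_law\<close>). Hence the hypotheses on the depth, which are about laws on the
  whole space, apply to the kernels. For the continuity in the kernel this is already the
  convergence of a factor.

  For the continuity in the path, the evaluation point and the law vary together. If \<open>x\<^sub>k \<rightarrow> x\<close> and
  \<open>y\<^sub>k \<rightarrow> y\<close>, with \<open>P\<^sub>k\<close> and \<open>P\<close> the extended laws at \<open>x\<^sub>k\<close> and \<open>x\<close>, then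
  \<open>\<bar>D P\<^sub>k y\<^sub>k - D P y\<bar> \<le> sup \<bar>D P\<^sub>k - D P\<bar> + \<bar>D P y\<^sub>k - D P y\<bar>\<close>.
  The uniform convergence handles the first term and the continuity of \<open>D P\<close> the second, so a
  factor is jointly continuous in \<open>(x, y)\<close> (\<open>continuous_on_transition_depth\<close>). The space of pairs
  is metric, so sequences suffice, and joint continuity passes to paths through
  the coordinate projections.\<close>

section \<open>Laws on a subspace and their extensions\<close>

lemma prob_laws_iff:
  "P \<in> prob_laws E \<longleftrightarrow> sets P = sets (restrict_space borel E) \<and> prob_space P"
  by (simp add: prob_laws_def space_prob_algebra)

lemma transition_probability_prob_laws:
  assumes "transition_probability E \<kappa>" "x \<in> E"
  shows "\<kappa> x \<in> prob_laws E"
  using assms measurable_space[of \<kappa> "restrict_space borel E" "prob_algebra (restrict_space borel E)" x]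
  by (simp add: transition_probability_def prob_laws_def space_restrict_space)

lemma measurable_inclusion_law:
  assumes "P \<in> prob_laws E"
  shows "(\<lambda>x. x) \<in> P \<rightarrow>\<^sub>M borel"
proof -
  have "(\<lambda>x. x) \<in> restrict_space borel E \<rightarrow>\<^sub>M borel"
    by (intro measurable_restrict_space1 measurable_ident_sets refl)
  moreover have "sets P = sets (restrict_space borel E)"
    using assms by (simp add: prob_laws_iff)
  ultimately show ?thesis
    by (simp cong: measurable_cong_sets)
qed

lemma extend_law_prob_laws:
  assumes "P \<in> prob_laws E"
  shows "extend_law P \<in> prob_laws UNIV"
proof -
  have "prob_space (extend_law P)"
    unfolding extend_law_def
    using assms by (intro prob_space.prob_space_distr measurable_inclusion_law) (auto simp: prob_laws_iff)
  then show ?thesis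
    by (simp add: prob_laws_iff extend_law_def sets_restrict_UNIV)
qed

lemma integral_extend_law:
  fixes f :: "'a::topological_space \<Rightarrow> real"
  assumes "P \<in> prob_laws E" "f \<in> borel_measurable borel"
  shows "integral\<^sup>L (extend_law P) f = integral\<^sup>L P f"
  unfolding extend_law_def
  using assms by (intro integral_distr measurable_inclusion_law)

text \<open>A bounded continuous test function on the whole space restricts to one on \<open>E\<close>, and its
  integral against the extended law is the integral of the restriction. A limit does not see
  the term of index 0, so that term may be arbitrary.\<close>

lemma weakly_converges_extend_law:
  assumes "\<And>n. 1 \<le> n \<Longrightarrow> Pn n \<in> prob_laws E" and P: "P \<in> prob_laws E"
    and conv: "weakly_converges E Pn P"
  shows "weakly_converges UNIV (\<lambda>n. extend_law (Pn n)) (extend_law P)"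
  unfolding weakly_converges_def
proof
  fix f :: "'a \<Rightarrow> real"
  assume f: "f \<in> bounded_cont UNIV"
  then have meas: "f \<in> borel_measurable borel"
    by (auto simp: bounded_cont_def intro: borel_measurable_continuous_onI)
  have "f \<in> bounded_cont E"
    using f by (auto simp: bounded_cont_def intro: continuous_on_subset bounded_subset)
  then have "(\<lambda>n. integral\<^sup>L (Pn n) f) \<longlonglongrightarrow> integral\<^sup>L P f"
    using conv by (simp add: weakly_converges_def)
  moreover have "\<forall>\<^sub>F n in sequentially. integral\<^sup>L (Pn n) f = integral\<^sup>L (extend_law (Pn n)) f"
    using assms(1) meas by (auto simp: integral_extend_law[of _ E] eventually_sequentially intro!: exI[of _ 1])
  ultimately show "(\<lambda>n. integral\<^sup>L (extend_law (Pn n)) f) \<longlonglongrightarrow> integral\<^sup>L (extend_law P) f"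
    using integral_extend_law[OF P meas] by (simp add: tendsto_cong)
qed

section \<open>Joint continuity of the depth of a transition\<close>

text \<open>The sets that generate the weak topology are the preimages of open sets under the maps
  \<open>P \<mapsto> integral\<^sup>L P f\<close>, which are therefore continuous.\<close>

lemma continuous_on_integral_kernel:
  assumes cont: "continuous_map (top_of_set E) (weak_topology E) \<kappa>"
    and laws: "\<And>x. x \<in> E \<Longrightarrow> \<kappa> x \<in> prob_laws E"
    and f: "f \<in> bounded_cont E"
  shows "continuous_on E (\<lambda>x. integral\<^sup>L (\<kappa> x) f)"
  unfolding continuous_openin_preimage_eq
proof (intro allI impI)
  fix U :: "real set"
  assume "open U"
  then have "openin (weak_topology E) {P \<in> prob_laws E. integral\<^sup>L P f \<in> U}"
    unfolding weak_topology_def using f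
    by (intro topology_generated_by_Basis) blast
  then have "openin (top_of_set E) {x \<in> E. \<kappa> x \<in> {P \<in> prob_laws E. integral\<^sup>L P f \<in> U}}"
    using openin_continuous_map_preimage[OF cont, of "{P \<in> prob_laws E. integral\<^sup>L P f \<in> U}"]
    by (simp only: topspace_euclidean_subtopology)
  moreover have "{x \<in> E. \<kappa> x \<in> {P \<in> prob_laws E. integral\<^sup>L P f \<in> U}}
      = E \<inter> (\<lambda>x. integral\<^sup>L (\<kappa> x) f) -` U"
    using laws by auto
  ultimately show "openin (top_of_set E) (E \<inter> (\<lambda>x. integral\<^sup>L (\<kappa> x) f) -` U)"
    by simp
qed

lemma weakly_converges_kernel:
  fixes E :: "'a::metric_space set"
  assumes "continuous_map (top_of_set E) (weak_topology E) \<kappa>"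
    and "\<And>x. x \<in> E \<Longrightarrow> \<kappa> x \<in> prob_laws E"
    and "\<And>k. u k \<in> E" "x \<in> E" "u \<longlonglongrightarrow> x"
  shows "weakly_converges E (\<lambda>k. \<kappa> (u k)) (\<kappa> x)"
  unfolding weakly_converges_def
  using continuous_on_integral_kernel[OF assms(1,2)] assms(3-5)
  by (auto simp: continuous_on_sequentially comp_def)

text \<open>Boundedness of depths matters here: on the reals, the supremum of a set that is not bounded
  above says nothing about its elements.\<close>

lemma statistical_depth_diff_le_SUP:
  assumes "statistical_depth D" "P \<in> prob_laws UNIV" "Q \<in> prob_laws UNIV"
  shows "\<bar>D P y - D Q y\<bar> \<le> (SUP x. \<bar>D P x - D Q x\<bar>)"
proof (rule cSUP_upper)
  have "bounded (range (D P))" "bounded (range (D Q))"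
    using assms by (auto simp: statistical_depth_def)
  then obtain a b where "\<And>x. \<bar>D P x\<bar> \<le> a" "\<And>x. \<bar>D Q x\<bar> \<le> b"
    by (auto simp: bounded_iff)
  then have "\<bar>D P x - D Q x\<bar> \<le> a + b" for x
    using abs_triangle_ineq4[of "D P x" "D Q x"] by (meson add_mono order_trans)
  then show "bdd_above (range (\<lambda>x. \<bar>D P x - D Q x\<bar>))"
    by (auto simp: bdd_above_def)
qed simp

text \<open>Pointwise convergence of the depths would give only separate continuity in \<open>x\<close> and \<open>y\<close>; uniform
  convergence lets the evaluation point move with the law.\<close>

lemma continuous_on_transition_depth:
  fixes D :: "(real^'d) measure \<Rightarrow> real^'d \<Rightarrow> real"
  assumes depth: "statistical_depth D"
    and laws: "\<And>x. x \<in> E \<Longrightarrow> \<kappa> x \<in> prob_laws E"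
    and cont_D: "\<And>P. P \<in> prob_laws UNIV \<Longrightarrow> continuous_on UNIV (D P)"
    and unif: "\<And>P Pn. P \<in> prob_laws UNIV \<Longrightarrow> (\<And>n. n \<ge> 1 \<Longrightarrow> Pn n \<in> prob_laws UNIV) \<Longrightarrow>
      weakly_converges UNIV Pn P \<Longrightarrow> (\<lambda>n. SUP x. \<bar>D (Pn n) x - D P x\<bar>) \<longlonglongrightarrow> 0"
    and cont_\<kappa>: "continuous_map (top_of_set E) (weak_topology E) \<kappa>"
  shows "continuous_on (E \<times> UNIV) (\<lambda>(x, y). D (extend_law (\<kappa> x)) y)"
  unfolding continuous_on_sequentially
proof (intro allI ballI impI, elim conjE)
  fix z :: "nat \<Rightarrow> (real^'d) \<times> (real^'d)" and w
  assume w: "w \<in> E \<times> UNIV" and "\<forall>n. z n \<in> E \<times> UNIV" and lim: "z \<longlonglongrightarrow> w"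
  then have z: "fst (z k) \<in> E" for k
    by (simp add: mem_Times_iff)
  define P where "P = extend_law (\<kappa> (fst w))"
  define Pk where "Pk k = extend_law (\<kappa> (fst (z k)))" for k
  have law: "P \<in> prob_laws UNIV" "Pk k \<in> prob_laws UNIV" for k
    using w z by (auto simp: P_def Pk_def intro!: extend_law_prob_laws laws)
  have "weakly_converges E (\<lambda>k. \<kappa> (fst (z k))) (\<kappa> (fst w))"
    using w z lim by (intro weakly_converges_kernel cont_\<kappa> laws) (auto intro: tendsto_fst)
  then have "weakly_converges UNIV Pk P"
    unfolding Pk_def P_def using w z by (intro weakly_converges_extend_law[of _ E] laws) auto
  then have sup: "(\<lambda>k. SUP y. \<bar>D (Pk k) y - D P y\<bar>) \<longlonglongrightarrow> 0"
    using law by (intro unif)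
  have "(\<lambda>k. D (Pk k) (snd (z k)) - D P (snd (z k))) \<longlonglongrightarrow> 0"
    using statistical_depth_diff_le_SUP[OF depth law(2) law(1)]
    by (intro Lim_null_comparison[OF _ sup]) simp
  moreover have "(\<lambda>k. D P (snd (z k))) \<longlonglongrightarrow> D P (snd w)"
    using continuous_on_tendsto_compose[OF cont_D[OF law(1)] tendsto_snd[OF lim]] by simp
  ultimately have "(\<lambda>k. D (Pk k) (snd (z k))) \<longlonglongrightarrow> D P (snd w)"
    using tendsto_add by fastforce
  then show "((\<lambda>(x, y). D (extend_law (\<kappa> x)) y) \<circ> z) \<longlonglongrightarrow> (\<lambda>(x, y). D (extend_law (\<kappa> x)) y) w"
    by (simp add: comp_def P_def Pk_def case_prod_beta)
qed

section \<open>From transitions to paths\<close>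

lemma continuous_map_from_sum_topology:
  assumes "\<And>i. i \<in> I \<Longrightarrow> continuous_map (X i) Y (f \<circ> Pair i)"
  shows "continuous_map (sum_topology X I) Y f"
proof -
  have "openin (X i) {x. (i, x) \<in> {p \<in> topspace (sum_topology X I). f p \<in> U}}"
    if "i \<in> I" "openin Y U" for i U
    using openin_continuous_map_preimage[OF assms[OF that(1)] that(2)] that(1) by simp
  moreover have "f \<in> topspace (sum_topology X I) \<rightarrow> topspace Y"
    using assms by (fastforce simp: continuous_map_def)
  ultimately show ?thesis
    by (auto simp: continuous_map_def openin_sum_topology)
qed

text \<open>One-point paths need no separate treatment: they have no transition, and the path depth is then a root of
  order 0, which is constantly 0. So the path depth is continuous on the whole path space.\<close>

lemma continuous_map_path_depth:
  fixes D :: "(real^'d) measure \<Rightarrow> real^'d \<Rightarrow> real"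
  assumes "continuous_on (E \<times> UNIV) (\<lambda>(x, y). D (extend_law (\<kappa> x)) y)"
  shows "continuous_map (path_topology E) euclideanreal (path_depth D \<kappa>)"
  unfolding path_topology_def
proof (rule continuous_map_from_sum_topology)
  fix m :: nat
  let ?X = "product_topology (\<lambda>_. top_of_set E) {..<m}"
  have coord: "continuous_map ?X (top_of_set E) (\<lambda>x. x i)" if "i < m" for i
    using that by (intro continuous_map_product_projection) simp
  have factor: "continuous_map ?X euclideanreal (\<lambda>x. D (extend_law (\<kappa> (x (i - 1)))) (x i))"
    if "i \<in> {1..m - 1}" for i
  proof -
    have "continuous_map ?X (prod_topology (top_of_set E) (top_of_set E)) (\<lambda>x. (x (i - 1), x i))"
      using that by (intro continuous_map_pairedI coord) auto
    then have pair: "continuous_map ?X (top_of_set (E \<times> E)) (\<lambda>x. (x (i - 1), x i))"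
      by (simp add: prod_topology_subtopology_eu)
    have "continuous_map (top_of_set (E \<times> E)) euclideanreal (\<lambda>(x, y). D (extend_law (\<kappa> x)) y)"
      using assms by (auto intro: continuous_on_subset)
    from continuous_map_compose[OF pair this] show ?thesis
      by (simp add: comp_def)
  qed
  have "continuous_map ?X euclideanreal
      (\<lambda>x. \<Prod>i = 1..m - 1. D (extend_law (\<kappa> (x (i - 1)))) (x i))"
    by (intro continuous_map_prod factor) auto
  moreover have "continuous_map euclideanreal euclideanreal (root (m - 1))"
    by (simp add: continuous_on_real_root)
  ultimately have "continuous_map ?X euclideanreal
      (root (m - 1) \<circ> (\<lambda>x. \<Prod>i = 1..m - 1. D (extend_law (\<kappa> (x (i - 1)))) (x i)))"
    by (rule continuous_map_compose)
  then show "continuous_map ?X euclideanreal (path_depth D \<kappa> \<circ> Pair m)"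
    by (simp add: path_depth_def comp_def Let_def)
qed

lemma tendsto_path_depth:
  fixes D :: "(real^'d) measure \<Rightarrow> real^'d \<Rightarrow> real"
  assumes p: "p \<in> paths E"
    and factor: "\<And>x y. x \<in> E \<Longrightarrow> y \<in> E \<Longrightarrow>
      (\<lambda>k. D (extend_law (\<kappa>n k x)) y) \<longlonglongrightarrow> D (extend_law (\<kappa> x)) y"
  shows "(\<lambda>k. path_depth D (\<kappa>n k) p) \<longlonglongrightarrow> path_depth D \<kappa> p"
proof -
  obtain m x where [simp]: "p = (m, x)" and m: "2 \<le> m" and x: "\<And>i. i < m \<Longrightarrow> x i \<in> E"
    using p by (force simp: paths_def)
  show ?thesis
    unfolding path_depth_def using m
    by (auto simp: Let_def intro!: tendsto_real_root tendsto_prod factor x)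
qed

theorem theorem2:
  fixes D :: "(real^'d) measure \<Rightarrow> real^'d \<Rightarrow> real"
    and E :: "(real^'d) set"
  assumes "statistical_depth D"
  shows
    "(\<forall>\<kappa>. transition_probability E \<kappa> \<longrightarrow>
        (\<forall>P \<in> prob_laws UNIV. continuous_on UNIV (D P)) \<longrightarrow>
        (\<forall>P Pn. P \<in> prob_laws UNIV \<longrightarrow> (\<forall>n\<ge>1. Pn n \<in> prob_laws UNIV) \<longrightarrow>
           weakly_converges UNIV Pn P \<longrightarrow>
           (\<lambda>n. SUP x. \<bar>D (Pn n) x - D P x\<bar>) \<longlonglongrightarrow> 0) \<longrightarrow>
        continuous_map (top_of_set E) (weak_topology E) \<kappa> \<longrightarrow>
        continuous_map (subtopology (path_topology E) (paths E)) euclideanreal (path_depth D \<kappa>))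
   \<and>
     ((\<forall>P Pn. P \<in> prob_laws UNIV \<longrightarrow> (\<forall>n\<ge>1. Pn n \<in> prob_laws UNIV) \<longrightarrow>
         weakly_converges UNIV Pn P \<longrightarrow>
         (\<forall>x. (\<lambda>n. \<bar>D (Pn n) x - D P x\<bar>) \<longlonglongrightarrow> 0)) \<longrightarrow>
      (\<forall>\<kappa> \<kappa>n. transition_probability E \<kappa> \<longrightarrow>
         (\<forall>n\<ge>1. transition_probability E (\<kappa>n n)) \<longrightarrow>
         (\<forall>x\<in>E. weakly_converges E (\<lambda>n. \<kappa>n n x) (\<kappa> x)) \<longrightarrow>
         (\<forall>p \<in> paths E. (\<lambda>n. path_depth D (\<kappa>n n) p) \<longlonglongrightarrow> path_depth D \<kappa> p)))"
proof (intro conjI allI impI ballI)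
  fix \<kappa>
  assume "transition_probability E \<kappa>"
    and "\<forall>P \<in> prob_laws UNIV. continuous_on UNIV (D P)"
    and "\<forall>P Pn. P \<in> prob_laws UNIV \<longrightarrow> (\<forall>n\<ge>1. Pn n \<in> prob_laws UNIV) \<longrightarrow>
      weakly_converges UNIV Pn P \<longrightarrow> (\<lambda>n. SUP x. \<bar>D (Pn n) x - D P x\<bar>) \<longlonglongrightarrow> 0"
    and "continuous_map (top_of_set E) (weak_topology E) \<kappa>"
  then have "continuous_on (E \<times> UNIV) (\<lambda>(x, y). D (extend_law (\<kappa> x)) y)"
    using assms
    by (intro continuous_on_transition_depth transition_probability_prob_laws) auto
  then show "continuous_map (subtopology (path_topology E) (paths E)) euclideanreal (path_depth D \<kappa>)"
    by (intro continuous_map_from_subtopology continuous_map_path_depth)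
next
  fix \<kappa> \<kappa>n p
  assume depth_conv: "\<forall>P Pn. P \<in> prob_laws UNIV \<longrightarrow> (\<forall>n\<ge>1. Pn n \<in> prob_laws UNIV) \<longrightarrow>
      weakly_converges UNIV Pn P \<longrightarrow> (\<forall>x. (\<lambda>n. \<bar>D (Pn n) x - D P x\<bar>) \<longlonglongrightarrow> 0)"
    and \<kappa>: "transition_probability E \<kappa>"
    and \<kappa>n: "\<forall>n\<ge>1. transition_probability E (\<kappa>n n)"
    and conv: "\<forall>x\<in>E. weakly_converges E (\<lambda>n. \<kappa>n n x) (\<kappa> x)"
    and p: "p \<in> paths E"
  show "(\<lambda>n. path_depth D (\<kappa>n n) p) \<longlonglongrightarrow> path_depth D \<kappa> p"
  proof (rule tendsto_path_depth[OF p])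
    fix x y
    assume x: "x \<in> E"
    have laws: "\<kappa> x \<in> prob_laws E" "\<And>n. 1 \<le> n \<Longrightarrow> \<kappa>n n x \<in> prob_laws E"
      using \<kappa> \<kappa>n x by (auto intro: transition_probability_prob_laws)
    then have "weakly_converges UNIV (\<lambda>n. extend_law (\<kappa>n n x)) (extend_law (\<kappa> x))"
      using conv x by (intro weakly_converges_extend_law[of _ E]) auto
    then have "(\<lambda>n. \<bar>D (extend_law (\<kappa>n n x)) y - D (extend_law (\<kappa> x)) y\<bar>) \<longlonglongrightarrow> 0"
      using depth_conv laws by (simp add: extend_law_prob_laws[of _ E])
    then show "(\<lambda>n. D (extend_law (\<kappa>n n x)) y) \<longlonglongrightarrow> D (extend_law (\<kappa> x)) y"
      by (simp add: tendsto_rabs_zero_iff LIM_zero_iff)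
  qed
qed

end
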